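(* Let $\mu>-1$, $q>-1$ and $0<\gamma<1$. If $x_0>0$ and $R'_{\mu,q,\gamma}(x_0)=0$, then $$R_{\mu,q,\gamma}(x_0)=\frac{1}{r_\mu(x_0)\{r_{\mu+1}(x_0)+(q+1)/x_0-\gamma\}}.$$ Moreover, $$M^*_{\mu,q,\gamma}=\max\left\{\frac{2(\mu+1)}{q+1},\ \frac1{1-\gamma},\ \sup_{x>0:\,R'_{\mu,q,\gamma}(x)=0}\frac{1}{r_\mu(x)\{r_{\mu+1}(x)+(q+1)/x-\gamma\}}\right\},$$ where the last entry is omitted if there are no stationary points.
   Context: $I_\alpha(x)=\sum_{k=0}^{\infty}\frac{(x/2)^{2k+\alpha}}{k!\,\Gamma(k+\alpha+1)}$, $x>0$, is the modified Bessel function of the first kind, and $r_\alpha(x)=I_{\alpha+1}(x)/I_\alpha(x)$. For $x>0$, $$R_{\mu,q,\gamma}(x)=\frac{\int_0^x e^{-\gamma t}t^{q-\mu}I_\mu(t)\,dt}{e^{-\gamma x}x^{q-\mu}I_{\mu+1}(x)},\qquad M^*_{\mu,q,\gamma}=\sup_{x>0}R_{\mu,q,\gamma}(x).$$ *)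

theory Defs
  imports "HOL-Analysis.Analysis" "HOL-Library.Extended_Real"
begin

text \<open>The terms are meaningful for positive \<open>x\<close> only. Both \<^const>\<open>Gamma\<close> at its poles and
  division by zero yield zero, which is the usual convention that the reciprocal of
  Gamma vanishes at the poles; the poles do not occur for \<open>\<alpha> > -1\<close>.\<close>

definition bessel_I :: "real \<Rightarrow> real \<Rightarrow> real" where
  "bessel_I \<alpha> x = (\<Sum>k. (x / 2) powr (2 * real k + \<alpha>) / (fact k * Gamma (real k + \<alpha> + 1)))"

definition bessel_r :: "real \<Rightarrow> real \<Rightarrow> real" where
  "bessel_r \<alpha> x = bessel_I (\<alpha> + 1) x / bessel_I \<alpha> x"

definition R_ratio :: "real \<Rightarrow> real \<Rightarrow> real \<Rightarrow> real \<Rightarrow> real" where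
  "R_ratio \<mu> q \<gamma> x =
     integral {0..x} (\<lambda>t. exp (- \<gamma> * t) * t powr (q - \<mu>) * bessel_I \<mu> t) /
     (exp (- \<gamma> * x) * x powr (q - \<mu>) * bessel_I (\<mu> + 1) x)"

text \<open>The supremum is formed in the extended reals, since the supremum of an unbounded set of
  reals is an unspecified value.\<close>

definition M_star :: "real \<Rightarrow> real \<Rightarrow> real \<Rightarrow> ereal" where
  "M_star \<mu> q \<gamma> = (SUP x\<in>{0<..}. ereal (R_ratio \<mu> q \<gamma> x))"

definition R_stationary :: "real \<Rightarrow> real \<Rightarrow> real \<Rightarrow> real set" where
  "R_stationary \<mu> q \<gamma> = {x. x > 0 \<and> (R_ratio \<mu> q \<gamma> has_real_derivative 0) (at x)}"

definition stationary_value :: "real \<Rightarrow> real \<Rightarrow> real \<Rightarrow> real \<Rightarrow> real" where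
  "stationary_value \<mu> q \<gamma> x =
     1 / (bessel_r \<mu> x * (bessel_r (\<mu> + 1) x + (q + 1) / x - \<gamma>))"

end

theory Submission
  imports Defs
begin

text \<open>
  Write \<open>R = N / D\<close> with \<open>N x\<close> the integral and \<open>D x = exp (-\<gamma> x) x\<^bsup>q-\<mu>\<^esup> I\<^bsub>\<mu>+1\<^esub>(x)\<close>. The recurrence
  \<open>I\<^sub>\<beta>' = I\<^bsub>\<beta>+1\<^esub> + (\<beta>/x) I\<^sub>\<beta>\<close> with \<open>\<beta> = \<mu> + 1\<close> shows that the logarithmic derivative of \<open>D\<close> is
  \<open>L x = r\<^bsub>\<mu>+1\<^esub>(x) + (q+1)/x - \<gamma>\<close>, while \<open>N' = D / r\<^sub>\<mu>\<close>. Hence \<open>R' = 1 / r\<^sub>\<mu> - R L\<close>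
  (\<open>R_ratio_deriv\<close>), and where \<open>R'\<close> vanishes, \<open>R\<close> has the value \<open>1 / (r\<^sub>\<mu> L)\<close>.

  The function \<open>1 / (r\<^sub>\<mu> L)\<close> is also \<open>N' / D'\<close>, so l'Hospital's rule gives the limits of \<open>R\<close> at
  both ends of the half-line once those of \<open>r\<^sub>\<mu> L\<close> are known: at \<open>0\<close> they come from
  \<open>r\<^sub>\<mu>(x) \<sim> x / (2 (\<mu>+1))\<close> and \<open>x L x \<rightarrow> q + 1\<close>, at infinity from \<open>r\<^sub>\<alpha>(x) \<rightarrow> 1\<close>
  (\<open>bessel_r_at_top\<close>), which also forces \<open>D\<close> to grow exponentially. The supremum of a differentiable
  function on the half-line is either one of its two end limits or a value at a stationary point
  (\<open>stationary_point_above_end_limits\<close>), and this is the claimed formula.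

  The limit of \<open>r\<^sub>\<alpha>\<close> at infinity is obtained by squeezing. The inequality between arithmetic and
  geometric means, applied to consecutive terms of the power series, gives \<open>r\<^sub>\<beta> \<le> 1\<close> for \<open>\<beta> \<ge> 0\<close>
  (\<open>bessel_clifford_index_mono\<close>). The continued-fraction step
  \<open>r\<^sub>\<alpha>(x) = 1 / (2 (\<alpha>+1)/x + r\<^bsub>\<alpha>+1\<^esub>(x))\<close> turns this upper bound into a lower bound with limit \<open>1\<close>
  for every \<open>\<alpha> > -1\<close>, and applied once more it turns the lower bound into an upper bound with
  limit \<open>1\<close>.
\<close>

section \<open>The Bessel--Clifford function\<close>

text \<open>Dividing \<open>I\<^sub>\<alpha>(x)\<close> by \<open>(x/2)\<^sup>\<alpha>\<close> and substituting \<open>y = (x/2)\<^sup>2\<close> leaves a power series that converges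
  everywhere, so that termwise differentiation and continuity at \<open>0\<close> come for free. Its derivative
  is the same series with the index raised by one.\<close>

definition bessel_clifford :: "real \<Rightarrow> real \<Rightarrow> real" where
  "bessel_clifford \<alpha> y = (\<Sum>k. 1 / (fact k * Gamma (real k + \<alpha> + 1)) * y ^ k)"

lemma Gamma_shift:
  assumes "\<alpha> > -1"
  shows "Gamma (real k + \<alpha> + 2) = (real k + \<alpha> + 1) * Gamma (real k + \<alpha> + 1)"
proof -
  have "real k + \<alpha> + 1 > 0" using assms by linarith
  then have "real k + \<alpha> + 1 \<notin> \<int>\<^sub>\<le>\<^sub>0" by (auto elim!: nonpos_Ints_cases)
  then show ?thesis
    using Gamma_plus1[of "real k + \<alpha> + 1"] by (simp add: add.assoc)
qed

lemma Gamma_pos: "\<alpha> > -1 \<Longrightarrow> Gamma (real k + \<alpha> + 1) > 0"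
  by (rule Gamma_real_pos) linarith

lemma summable_bessel_clifford:
  assumes "\<alpha> > -1"
  shows "summable (\<lambda>k. 1 / (fact k * Gamma (real k + \<alpha> + 1)) * y ^ k)"
proof (rule summable_ratio_test[of "1/2" "nat \<lceil>2 * \<bar>y\<bar>\<rceil> + 1"])
  fix k assume k: "k \<ge> nat \<lceil>2 * \<bar>y\<bar>\<rceil> + 1"
  let ?m = "real k + \<alpha> + 1" and ?g = "fact k * Gamma (real k + \<alpha> + 1)"
  have "2 * \<bar>y\<bar> \<le> real k" "k \<ge> 1" using k by linarith+
  then have "2 * \<bar>y\<bar> \<le> (real k + 1) * ?m" 
    using mult_mono[of "2 * \<bar>y\<bar>" "real k + 1" 1 ?m] assms by simp
  moreover have pos: "?m > 0" "?g > 0" using assms Gamma_pos[of \<alpha> k] by auto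
  ultimately have le: "\<bar>y\<bar> / ((real k + 1) * ?m) \<le> 1/2"
    by (simp add: divide_simps)
  have "norm (1 / (fact (Suc k) * Gamma (real (Suc k) + \<alpha> + 1)) * y ^ Suc k)
      = \<bar>y\<bar> / ((real k + 1) * ?m) * (\<bar>y\<bar> ^ k / ?g)"
    using pos Gamma_shift[OF assms, of k] assms
    by (simp add: abs_mult power_abs add_ac divide_simps)
  also have "\<dots> \<le> 1/2 * (\<bar>y\<bar> ^ k / ?g)"
    using le pos by (intro mult_right_mono) auto
  also have "\<dots> = 1/2 * norm (1 / ?g * y ^ k)"
    using pos by (simp add: abs_mult power_abs)
  finally show "norm (1 / (fact (Suc k) * Gamma (real (Suc k) + \<alpha> + 1)) * y ^ Suc k)
      \<le> 1/2 * norm (1 / ?g * y ^ k)" .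
qed simp

lemma bessel_clifford_at_0: "bessel_clifford \<alpha> 0 = 1 / Gamma (\<alpha> + 1)"
  using powser_zero[of "\<lambda>k. 1 / (fact k * Gamma (real k + \<alpha> + 1))"]
  by (simp add: bessel_clifford_def)

lemma bessel_clifford_pos:
  assumes "\<alpha> > -1" "y \<ge> 0"
  shows "bessel_clifford \<alpha> y > 0"
  unfolding bessel_clifford_def
proof (rule suminf_pos2[where i = 0])
  show "0 \<le> 1 / (fact k * Gamma (real k + \<alpha> + 1)) * y ^ k" for k
    using Gamma_pos[OF assms(1), of k] assms(2) by simp
qed (use summable_bessel_clifford[OF assms(1)] Gamma_pos[OF assms(1), of 0] in auto)

lemma has_derivative_bessel_clifford:
  assumes "\<alpha> > -1"
  shows "(bessel_clifford \<alpha> has_real_derivative bessel_clifford (\<alpha> + 1) y) (at y)"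
proof -
  let ?c = "\<lambda>k. 1 / (fact k * Gamma (real k + \<alpha> + 1))"
  have "((\<lambda>y. \<Sum>k. ?c k * y ^ k) has_field_derivative (\<Sum>k. diffs ?c k * y ^ k)) (at y)"
    by (rule termdiffs_strong_converges_everywhere) (rule summable_bessel_clifford[OF assms])
  moreover have "diffs ?c = (\<lambda>k. 1 / (fact k * Gamma (real k + (\<alpha> + 1) + 1)))"
    by (auto simp: diffs_def fun_eq_iff add_ac divide_simps)
  ultimately show ?thesis
    by (simp add: bessel_clifford_def [abs_def])
qed

lemma isCont_bessel_clifford: "\<alpha> > -1 \<Longrightarrow> isCont (bessel_clifford \<alpha>) y"
  using has_derivative_bessel_clifford DERIV_isCont by blast

text \<open>The coefficients satisfy \<open>1 / \<Gamma>(k+\<alpha>+1) = ((\<alpha>+1) + k) / \<Gamma>(k+\<alpha>+2)\<close>. The summand \<open>\<alpha> + 1\<close> gives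
  the first series on the right; the summand \<open>k\<close> cancels against \<open>k!\<close> and gives the second one,
  shifted by one index.\<close>

lemma bessel_clifford_recurrence:
  assumes "\<alpha> > -1"
  shows "bessel_clifford \<alpha> y = (\<alpha> + 1) * bessel_clifford (\<alpha> + 1) y + y * bessel_clifford (\<alpha> + 2) y"
proof -
  let ?c = "\<lambda>\<alpha> k. 1 / (fact k * Gamma (real k + \<alpha> + 1)) * y ^ k"
  have s: "summable (?c \<beta>)" "?c \<beta> sums bessel_clifford \<beta> y" if "\<beta> > -1" for \<beta>
    using summable_bessel_clifford[OF that] by (auto simp: bessel_clifford_def summable_sums)
  have "(\<lambda>k. y * ?c (\<alpha> + 2) k) sums (y * bessel_clifford (\<alpha> + 2) y)"
    using assms by (intro sums_mult s) auto
  also have "(\<lambda>k. y * ?c (\<alpha> + 2) k) = (\<lambda>k. real (Suc k) * ?c (\<alpha> + 1) (Suc k))"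
    by (auto simp: fun_eq_iff add_ac divide_simps)
  finally have "(\<lambda>k. real k * ?c (\<alpha> + 1) k) sums (y * bessel_clifford (\<alpha> + 2) y)"
    using sums_Suc_iff[of "\<lambda>k. real k * ?c (\<alpha> + 1) k"] by simp
  moreover have "(\<lambda>k. (\<alpha> + 1) * ?c (\<alpha> + 1) k) sums ((\<alpha> + 1) * bessel_clifford (\<alpha> + 1) y)"
    using assms by (intro sums_mult s) auto
  ultimately have "(\<lambda>k. (\<alpha> + 1) * ?c (\<alpha> + 1) k + real k * ?c (\<alpha> + 1) k) sums
      ((\<alpha> + 1) * bessel_clifford (\<alpha> + 1) y + y * bessel_clifford (\<alpha> + 2) y)"
    using sums_add by blast
  also have "(\<lambda>k. (\<alpha> + 1) * ?c (\<alpha> + 1) k + real k * ?c (\<alpha> + 1) k) = ?c \<alpha>"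
  proof
    fix k
    have m: "real k + \<alpha> + 1 > 0" using assms by simp
    have shift: "real k + (\<alpha> + 1) + 1 = real k + \<alpha> + 2" by simp
    have "?c (\<alpha> + 1) k = ?c \<alpha> k / (real k + \<alpha> + 1)"
      unfolding shift Gamma_shift[OF assms] by (simp add: mult_ac)
    then have "(\<alpha> + 1) * ?c (\<alpha> + 1) k + real k * ?c (\<alpha> + 1) k
        = (real k + \<alpha> + 1) * (?c \<alpha> k / (real k + \<alpha> + 1))"
      by (simp only: distrib_right[symmetric]) (simp only: add_ac)
    also have "\<dots> = ?c \<alpha> k" using m by simp
    finally show "(\<alpha> + 1) * ?c (\<alpha> + 1) k + real k * ?c (\<alpha> + 1) k = ?c \<alpha> k" .
  qed
  finally show ?thesis
    using s(2)[OF assms] sums_unique2 by blast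
qed

text \<open>Up to the factor \<open>s\<^sup>\<beta>\<close> this is \<open>I\<^bsub>\<beta>+1\<^esub>(2s) \<le> I\<^sub>\<beta>(2s)\<close>. If \<open>a\<^sub>k\<close> are the terms of the series on the
  right and \<open>b\<^sub>k\<close> those on the left, then
  \<open>b\<^sub>k\<^sup>2 = a\<^sub>k a\<^bsub>k+1\<^esub> (k+1) / (k+\<beta>+1) \<le> a\<^sub>k a\<^bsub>k+1\<^esub>\<close>, so \<open>b\<^sub>k\<close> is at most the arithmetic mean of two
  consecutive terms, and the sum of these means is at most the sum of all \<open>a\<^sub>k\<close>.\<close>

lemma bessel_clifford_index_mono:
  assumes "\<beta> \<ge> 0" "s \<ge> 0"
  shows "s * bessel_clifford (\<beta> + 1) (s ^ 2) \<le> bessel_clifford \<beta> (s ^ 2)"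
proof -
  let ?c = "\<lambda>\<alpha> k. 1 / (fact k * Gamma (real k + \<alpha> + 1)) * (s ^ 2) ^ k"
  have s: "?c \<alpha> sums bessel_clifford \<alpha> (s ^ 2)" if "\<alpha> > -1" for \<alpha>
    using summable_bessel_clifford[OF that] by (auto simp: bessel_clifford_def summable_sums)
  have pos: "Gamma (real k + \<beta> + 1) > 0" for k using assms Gamma_pos[of \<beta> k] by auto
  have "s * ?c (\<beta> + 1) k \<le> (?c \<beta> k + ?c \<beta> (Suc k)) / 2" for k
  proof -
    define p where "p = real k + 1"
    define m where "m = real k + \<beta> + 1"
    have pm: "0 < p" "p \<le> m" using assms by (auto simp: p_def m_def)
    have "2 * (s / m) \<le> 1 + (s / m) ^ 2"
      using sum_squares_bound[of "s / m" 1] by simp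
    also have "(s / m) ^ 2 \<le> s ^ 2 / (p * m)"
      unfolding power_divide using pm by (intro divide_left_mono) (auto simp: power2_eq_square)
    finally have le: "2 * (s / m) \<le> 1 + s ^ 2 / (p * m)" by simp
    have g: "Gamma (real k + \<beta> + 2) = m * Gamma (real k + \<beta> + 1)"
      using Gamma_shift[of \<beta> k] assms by (simp add: m_def)
    have "real k + (\<beta> + 1) + 1 = real k + \<beta> + 2" "real (Suc k) + \<beta> + 1 = real k + \<beta> + 2"
      by simp_all
    then have 1: "s * ?c (\<beta> + 1) k = ?c \<beta> k * (s / m)"
      and 2: "?c \<beta> (Suc k) = ?c \<beta> k * (s ^ 2 / (p * m))"
      using pm g by (simp_all add: p_def algebra_simps)
    have "?c \<beta> k * (2 * (s / m)) \<le> ?c \<beta> k * (1 + s ^ 2 / (p * m))"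
      using le pos[of k] by (intro mult_left_mono) auto
    moreover have halve: "A * t \<le> (A + A * u) / 2" if "A * (2 * t) \<le> A * (1 + u)" for A t u :: real
      using that by (simp add: algebra_simps)
    ultimately show ?thesis unfolding 1 2 by (intro halve)
  qed
  moreover have "(\<lambda>k. s * ?c (\<beta> + 1) k) sums (s * bessel_clifford (\<beta> + 1) (s ^ 2))"
    using assms by (intro sums_mult s) auto
  moreover have "(\<lambda>k. (?c \<beta> k + ?c \<beta> (Suc k)) / 2) sums
      ((bessel_clifford \<beta> (s ^ 2) + (bessel_clifford \<beta> (s ^ 2) - ?c \<beta> 0)) / 2)"
  proof (intro sums_divide sums_add iffD2[OF sums_Suc_iff[of "?c \<beta>"]])
    show "?c \<beta> sums bessel_clifford \<beta> (s ^ 2)"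
      "?c \<beta> sums (bessel_clifford \<beta> (s ^ 2) - ?c \<beta> 0 + ?c \<beta> 0)"
      using s[of \<beta>] assms(1) unfolding diff_add_cancel by simp_all
  qed
  ultimately have "s * bessel_clifford (\<beta> + 1) (s ^ 2)
      \<le> (bessel_clifford \<beta> (s ^ 2) + (bessel_clifford \<beta> (s ^ 2) - ?c \<beta> 0)) / 2"
    by (rule sums_le)
  also have "\<dots> \<le> bessel_clifford \<beta> (s ^ 2)"
    using pos[of 0] by simp
  finally show ?thesis .
qed

section \<open>Ratios of modified Bessel functions\<close>

lemma bessel_I_eq:
  assumes "x \<ge> 0" "\<alpha> > -1"
  shows "bessel_I \<alpha> x = (x / 2) powr \<alpha> * bessel_clifford \<alpha> ((x / 2) ^ 2)"
proof -
  have "(x / 2) powr (2 * real k + \<alpha>) = (x / 2) powr \<alpha> * ((x / 2) ^ 2) ^ k" for k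
    using assms powr_realpow[of "x / 2" "2 * k"]
    by (cases "x = 0") (simp_all add: powr_add power_mult)
  then show ?thesis
    using suminf_mult[OF summable_bessel_clifford[OF assms(2)],
        of "(x / 2) powr \<alpha>" "(x / 2) ^ 2"]
    by (simp add: bessel_I_def bessel_clifford_def)
qed

lemma bessel_I_pos: "x > 0 \<Longrightarrow> \<alpha> > -1 \<Longrightarrow> bessel_I \<alpha> x > 0"
  by (simp add: bessel_I_eq bessel_clifford_pos)

lemma bessel_r_eq:
  assumes "x > 0" "\<alpha> > -1"
  shows "bessel_r \<alpha> x
    = x / 2 * bessel_clifford (\<alpha> + 1) ((x / 2) ^ 2) / bessel_clifford \<alpha> ((x / 2) ^ 2)"
  using assms by (simp add: bessel_r_def bessel_I_eq powr_add)

lemma bessel_r_pos: "x > 0 \<Longrightarrow> \<alpha> > -1 \<Longrightarrow> bessel_r \<alpha> x > 0"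
  by (simp add: bessel_r_def bessel_I_pos)

lemma bessel_r_le_1: "x > 0 \<Longrightarrow> \<beta> \<ge> 0 \<Longrightarrow> bessel_r \<beta> x \<le> 1"
  using bessel_clifford_index_mono[of \<beta> "x / 2"] bessel_clifford_pos[of \<beta> "(x / 2) ^ 2"]
  by (simp add: bessel_r_eq)

lemma bessel_r_recurrence:
  assumes "x > 0" "\<alpha> > -1"
  shows "bessel_r \<alpha> x = 1 / (2 * (\<alpha> + 1) / x + bessel_r (\<alpha> + 1) x)"
proof -
  define s where "s = x / 2"
  let ?C = "\<lambda>\<alpha>. bessel_clifford \<alpha> (s ^ 2)"
  have pos: "s > 0" "?C \<alpha> > 0" "?C (\<alpha> + 1) > 0"
    using assms by (simp_all add: s_def bessel_clifford_pos)
  have "2 * (\<alpha> + 1) / x + bessel_r (\<alpha> + 1) x = (\<alpha> + 1) / s + s * ?C (\<alpha> + 2) / ?C (\<alpha> + 1)"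
    using assms by (simp add: bessel_r_eq s_def add.assoc)
  also have "\<dots> = ((\<alpha> + 1) * ?C (\<alpha> + 1) + s ^ 2 * ?C (\<alpha> + 2)) / (s * ?C (\<alpha> + 1))"
    using pos by (simp add: divide_simps power2_eq_square)
  also have "\<dots> = ?C \<alpha> / (s * ?C (\<alpha> + 1))"
    using bessel_clifford_recurrence[OF assms(2), of "s ^ 2"] by simp
  finally show ?thesis
    using assms by (simp add: bessel_r_eq s_def)
qed

lemma bessel_r_lower_bound:
  assumes "x > 0" "\<alpha> > -1"
  shows "bessel_r \<alpha> x \<ge> 1 / (2 * (\<alpha> + 1) / x + 1)"
proof -
  have "0 < 2 * (\<alpha> + 1) / x" using assms by simp
  moreover have "0 < bessel_r (\<alpha> + 1) x" "bessel_r (\<alpha> + 1) x \<le> 1"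
    using assms by (auto intro!: bessel_r_pos bessel_r_le_1)
  ultimately show ?thesis
    unfolding bessel_r_recurrence[OF assms] by (intro divide_left_mono mult_pos_pos) auto
qed

text \<open>One continued-fraction step from \<open>r\<^bsub>\<alpha>+1\<^esub> \<le> 1\<close> yields the lower bound, and one step from the lower
  bound for \<open>r\<^bsub>\<alpha>+1\<^esub>\<close> yields the upper bound.\<close>

lemma bessel_r_at_top:
  assumes "\<alpha> > -1"
  shows "(bessel_r \<alpha> \<longlongrightarrow> 1) at_top"
proof (rule tendsto_sandwich)
  have lim: "((\<lambda>x. c / x) \<longlongrightarrow> 0) at_top" for c :: real
    by (rule tendsto_divide_0[OF tendsto_const]) (simp add: filterlim_ident filterlim_at_top_imp_at_infinity)
  have lower: "((\<lambda>x. 1 / (2 * (\<beta> + 1) / x + 1)) \<longlongrightarrow> 1) at_top" for \<beta> :: real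
    using tendsto_divide[OF tendsto_const[of 1]
        tendsto_add[OF lim[of "2 * (\<beta> + 1)"] tendsto_const[of 1]]] by simp
  then show "((\<lambda>x. 1 / (2 * (\<alpha> + 1) / x + 1)) \<longlongrightarrow> 1) at_top" .
  show "((\<lambda>x. 1 / (2 * (\<alpha> + 1) / x + 1 / (2 * (\<alpha> + 1 + 1) / x + 1))) \<longlongrightarrow> 1) at_top"
    using tendsto_divide[OF tendsto_const[of 1]
        tendsto_add[OF lim[of "2 * (\<alpha> + 1)"] lower[of "\<alpha> + 1"]]] by simp
  show "\<forall>\<^sub>F x in at_top. 1 / (2 * (\<alpha> + 1) / x + 1) \<le> bessel_r \<alpha> x"
    using eventually_gt_at_top[of 0]
    by eventually_elim (use assms bessel_r_lower_bound in auto)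
  show "\<forall>\<^sub>F x in at_top. bessel_r \<alpha> x
      \<le> 1 / (2 * (\<alpha> + 1) / x + 1 / (2 * (\<alpha> + 1 + 1) / x + 1))"
    using eventually_gt_at_top[of 0]
  proof eventually_elim
    case (elim x)
    have "0 < 2 * (\<alpha> + 1) / x" "0 < 2 * (\<alpha> + 1 + 1) / x" using elim assms by simp_all
    moreover have "1 / (2 * (\<alpha> + 1 + 1) / x + 1) \<le> bessel_r (\<alpha> + 1) x"
      using bessel_r_lower_bound[of x "\<alpha> + 1"] elim assms by simp
    moreover have "0 < bessel_r (\<alpha> + 1) x"
      using bessel_r_pos[of x "\<alpha> + 1"] elim assms by simp
    ultimately show ?case
      unfolding bessel_r_recurrence[OF elim assms]
      by (intro divide_left_mono add_left_mono mult_pos_pos add_pos_pos) auto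
  qed
qed

lemma bessel_r_over_x_at_0:
  assumes "\<alpha> > -1"
  shows "((\<lambda>x. bessel_r \<alpha> x / x) \<longlongrightarrow> 1 / (2 * (\<alpha> + 1))) (at_right 0)"
proof -
  let ?h = "\<lambda>x. 1 / 2 * bessel_clifford (\<alpha> + 1) ((x / 2) ^ 2) / bessel_clifford \<alpha> ((x / 2) ^ 2)"
  have "isCont ?h 0"
    using assms bessel_clifford_pos[of \<alpha> 0] 
    by (intro continuous_intros isCont_o2[OF _ isCont_bessel_clifford]) auto
  moreover have "Gamma (\<alpha> + 1) \<noteq> 0"
    by (rule less_imp_neq[THEN not_sym]) (use Gamma_pos[OF assms, of 0] in simp)
  with Gamma_shift[OF assms, of 0] have "?h 0 = 1 / (2 * (\<alpha> + 1))"
    by (simp add: bessel_clifford_at_0 add.assoc)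
  ultimately have "(?h \<longlongrightarrow> 1 / (2 * (\<alpha> + 1))) (at 0)"
    using isContD[of 0 ?h] by (simp only:)
  then have "(?h \<longlongrightarrow> 1 / (2 * (\<alpha> + 1))) (at_right 0)"
    by (rule tendsto_within_subset) simp
  moreover have "\<forall>\<^sub>F x in at_right 0. ?h x = bessel_r \<alpha> x / x"
    using eventually_at_right_less[of 0]
    by eventually_elim (simp add: bessel_r_eq assms)
  ultimately show ?thesis by (rule Lim_transform_eventually)
qed

section \<open>Integrals from an integrable singularity\<close>

text \<open>For \<open>q < 0\<close> the integrand of \<open>R\<close> is unbounded near \<open>0\<close>, but it is \<open>t\<^sup>q\<close> times a function that
  is continuous on the whole line. The next three lemmas treat integrals of that kind.\<close>

lemma integrable_powr_times_continuous:
  fixes h :: "real \<Rightarrow> real"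
  assumes "q > -1" "continuous_on UNIV h" "x \<ge> 0"
  shows "(\<lambda>t. t powr q * h t) integrable_on {0..x}"
proof -
  have "(\<lambda>t. t powr q) absolutely_integrable_on {0..x}"
    using has_integral_powr_from_0[OF assms(1,3)]
    by (intro nonnegative_absolutely_integrable_1) auto
  moreover have cont: "continuous_on {0..x} h" using assms(2) continuous_on_subset by blast
  then have "h \<in> borel_measurable (lebesgue_on {0..x})" "bounded (h ` {0..x})"
    by (auto intro!: continuous_imp_measurable_on_sets_lebesgue compact_imp_bounded compact_continuous_image)
  ultimately have "(\<lambda>t. h t * t powr q) absolutely_integrable_on {0..x}"
    by (intro absolutely_integrable_bounded_measurable_product_real) auto
  then show ?thesis
    by (simp add: absolutely_integrable_on_def mult.commute)
qed

text \<open>The fundamental theorem of calculus applies away from the singularity; the part of the integral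
  over \<open>{0..x/2}\<close> is a constant near \<open>x\<close>.\<close>

lemma integral_powr_times_continuous_deriv:
  fixes h :: "real \<Rightarrow> real"
  assumes "q > -1" "continuous_on UNIV h" "x > 0"
  shows "((\<lambda>x. integral {0..x} (\<lambda>t. t powr q * h t)) has_real_derivative x powr q * h x) (at x)"
proof -
  let ?f = "\<lambda>t. t powr q * h t"
  have "continuous_on {x / 2..2 * x} ?f"
    using assms by (intro continuous_intros continuous_on_subset[OF assms(2)]) auto
  then have "((\<lambda>u. integral {x / 2..u} ?f) has_real_derivative ?f x) (at x within {x / 2..2 * x})"
    using assms by (intro integral_has_real_derivative) auto
  then have "((\<lambda>u. integral {x / 2..u} ?f) has_real_derivative ?f x) (at x)"
    using assms(3) at_within_Icc_at[of "x / 2" x "2 * x"] by simp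
  then have "((\<lambda>u. integral {0..x / 2} ?f + integral {x / 2..u} ?f) has_real_derivative ?f x) (at x)"
    by (auto intro!: derivative_eq_intros)
  then show ?thesis
  proof (rule has_field_derivative_transform_within_open[where S = "{x / 2<..}"])
    fix u assume "u \<in> {x / 2<..}"
    then show "integral {0..x / 2} ?f + integral {x / 2..u} ?f = integral {0..u} ?f"
      using assms
      by (intro Henstock_Kurzweil_Integration.integral_combine integrable_powr_times_continuous) auto
  qed (use assms in auto)
qed

lemma integral_powr_times_continuous_at_0:
  fixes h :: "real \<Rightarrow> real"
  assumes "q > -1" "continuous_on UNIV h"
  shows "((\<lambda>x. integral {0..x} (\<lambda>t. t powr q * h t)) \<longlongrightarrow> 0) (at_right 0)"
proof -
  let ?f = "\<lambda>t. t powr q * h t"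
  have "continuous_on {0..1} (\<lambda>x. integral {0..x} ?f)"
    using integrable_powr_times_continuous[OF assms, of 1]
    by (intro indefinite_integral_continuous_1) auto
  then have "((\<lambda>x. integral {0..x} ?f) \<longlongrightarrow> integral {0..0} ?f) (at 0 within {0..1})"
    unfolding continuous_on_def by (rule bspec) simp
  then show ?thesis by (simp add: at_within_Icc_at_right)
qed

section \<open>The ratio and its derivative\<close>

definition ratio_num :: "real \<Rightarrow> real \<Rightarrow> real \<Rightarrow> real \<Rightarrow> real" where
  "ratio_num \<mu> q \<gamma> x = integral {0..x} (\<lambda>t. exp (- \<gamma> * t) * t powr (q - \<mu>) * bessel_I \<mu> t)"

definition ratio_den :: "real \<Rightarrow> real \<Rightarrow> real \<Rightarrow> real \<Rightarrow> real" where
  "ratio_den \<mu> q \<gamma> x = exp (- \<gamma> * x) * x powr (q - \<mu>) * bessel_I (\<mu> + 1) x"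

definition ratio_den_logderiv :: "real \<Rightarrow> real \<Rightarrow> real \<Rightarrow> real \<Rightarrow> real" where
  "ratio_den_logderiv \<mu> q \<gamma> x = bessel_r (\<mu> + 1) x + (q + 1) / x - \<gamma>"

lemma R_ratio_eq: "R_ratio \<mu> q \<gamma> x = ratio_num \<mu> q \<gamma> x / ratio_den \<mu> q \<gamma> x"
  by (simp add: R_ratio_def ratio_num_def ratio_den_def)

text \<open>The equation also holds at \<open>t = 0\<close>, where both sides are \<open>0\<close> because \<open>0 powr a = 0\<close> for
  every \<open>a\<close>.\<close>

lemma ratio_integrand_eq:
  assumes "\<mu> > -1" "t \<ge> 0"
  shows "exp (- \<gamma> * t) * t powr (q - \<mu>) * bessel_I \<mu> t
    = t powr q * (exp (- \<gamma> * t) * 2 powr - \<mu> * bessel_clifford \<mu> ((t / 2) ^ 2))"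
  using assms
  by (cases "t = 0") (simp_all add: bessel_I_eq powr_diff powr_divide powr_minus divide_simps)

lemma continuous_ratio_weight:
  assumes "\<mu> > -1"
  shows "continuous_on UNIV (\<lambda>t. exp (- \<gamma> * t) * 2 powr - \<mu> * bessel_clifford \<mu> ((t / 2) ^ 2))"
  by (intro continuous_at_imp_continuous_on ballI continuous_intros
      isCont_o2[OF _ isCont_bessel_clifford[OF assms]]) auto

lemma ratio_num_eq:
  assumes "\<mu> > -1"
  shows "ratio_num \<mu> q \<gamma> x = integral {0..x}
    (\<lambda>t. t powr q * (exp (- \<gamma> * t) * 2 powr - \<mu> * bessel_clifford \<mu> ((t / 2) ^ 2)))"
  unfolding ratio_num_def using ratio_integrand_eq[OF assms]
  by (intro Henstock_Kurzweil_Integration.integral_cong) auto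

lemma ratio_den_eq:
  assumes "\<mu> > -1" "x > 0"
  shows "ratio_den \<mu> q \<gamma> x
    = 2 powr - (\<mu> + 1) * (exp (- \<gamma> * x) * x powr (q + 1) * bessel_clifford (\<mu> + 1) ((x / 2) ^ 2))"
  using assms
  by (simp add: ratio_den_def bessel_I_eq powr_diff powr_divide powr_minus powr_add divide_simps)

lemma ratio_den_pos: "\<mu> > -1 \<Longrightarrow> x > 0 \<Longrightarrow> ratio_den \<mu> q \<gamma> x > 0"
  by (simp add: ratio_den_def bessel_I_pos)

text \<open>The derivative is the integrand, written with the denominator so that \<open>D\<close> cancels in \<open>N' / D'\<close>.\<close>

lemma ratio_num_deriv:
  assumes "\<mu> > -1" "q > -1" "x > 0"
  shows "(ratio_num \<mu> q \<gamma> has_real_derivative ratio_den \<mu> q \<gamma> x / bessel_r \<mu> x) (at x)"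
proof -
  have "ratio_den \<mu> q \<gamma> x / bessel_r \<mu> x = exp (- \<gamma> * x) * x powr (q - \<mu>) * bessel_I \<mu> x"
    using bessel_I_pos[of x \<mu>] bessel_I_pos[of x "\<mu> + 1"] assms
    by (simp add: ratio_den_def bessel_r_def)
  also have "\<dots> = x powr q * (exp (- \<gamma> * x) * 2 powr - \<mu> * bessel_clifford \<mu> ((x / 2) ^ 2))"
    using assms by (intro ratio_integrand_eq) auto
  finally show ?thesis
    using integral_powr_times_continuous_deriv[OF assms(2) continuous_ratio_weight[OF assms(1)] assms(3)]
    by (simp add: ratio_num_eq[OF assms(1), abs_def])
qed

lemma ratio_den_deriv:
  assumes "\<mu> > -1" "x > 0"
  shows "(ratio_den \<mu> q \<gamma> has_real_derivative ratio_den \<mu> q \<gamma> x * ratio_den_logderiv \<mu> q \<gamma> x) (at x)"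
proof -
  let ?C = "\<lambda>\<alpha>. bessel_clifford \<alpha> ((x / 2) ^ 2)"
  have "((\<lambda>x. bessel_clifford (\<mu> + 1) ((x / 2) ^ 2)) has_real_derivative
      ?C (\<mu> + 1 + 1) * (x / 2)) (at x)"
    using assms
    by (intro DERIV_chain2[OF has_derivative_bessel_clifford]) (auto intro!: derivative_eq_intros)
  moreover have "?C (\<mu> + 1 + 1) * (x / 2) = bessel_r (\<mu> + 1) x * ?C (\<mu> + 1)"
    using assms bessel_clifford_pos[of "\<mu> + 1" "(x / 2) ^ 2"] by (simp add: bessel_r_eq)
  ultimately have C: "((\<lambda>x. bessel_clifford (\<mu> + 1) ((x / 2) ^ 2)) has_real_derivative
      bessel_r (\<mu> + 1) x * ?C (\<mu> + 1)) (at x)"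
    by simp
  have P: "((\<lambda>x. x powr (q + 1)) has_real_derivative (q + 1) / x * x powr (q + 1)) (at x)"
    using has_real_derivative_powr[OF assms(2), of "q + 1"] assms(2) by (simp add: powr_add)
  have E: "((\<lambda>x. exp (- \<gamma> * x)) has_real_derivative - \<gamma> * exp (- \<gamma> * x)) (at x)"
    by (auto intro!: derivative_eq_intros)
  have "((\<lambda>x. 2 powr - (\<mu> + 1) * (exp (- \<gamma> * x) * x powr (q + 1) * bessel_clifford (\<mu> + 1) ((x / 2) ^ 2)))
      has_real_derivative ratio_den \<mu> q \<gamma> x * ratio_den_logderiv \<mu> q \<gamma> x) (at x)"
    unfolding ratio_den_eq[OF assms] ratio_den_logderiv_def
    by (rule DERIV_cong[OF DERIV_cmult[OF DERIV_mult[OF DERIV_mult[OF E P] C]]])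
      (simp add: algebra_simps)
  then show ?thesis
    by (rule has_field_derivative_transform_within_open[where S = "{0<..}"])
      (use assms in \<open>auto simp: ratio_den_eq\<close>)
qed

lemma R_ratio_deriv:
  assumes "\<mu> > -1" "q > -1" "x > 0"
  shows "(R_ratio \<mu> q \<gamma> has_real_derivative
    1 / bessel_r \<mu> x - R_ratio \<mu> q \<gamma> x * ratio_den_logderiv \<mu> q \<gamma> x) (at x)"
  unfolding R_ratio_eq[abs_def]
  using ratio_den_pos[OF assms(1,3), of q \<gamma>] bessel_r_pos[OF assms(3,1)]
  by (intro DERIV_cong[OF DERIV_divide[OF ratio_num_deriv[OF assms] ratio_den_deriv[OF assms(1,3)]]])
    (auto simp: diff_divide_distrib)

text \<open>At a stationary point \<open>R L = 1 / r\<^sub>\<mu>\<close>. The right-hand side is positive, so \<open>L\<close> is nonzero there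
  and the equation can be solved for \<open>R\<close>.\<close>

lemma R_ratio_at_stationary:
  assumes "\<mu> > -1" "q > -1" "x > 0" "(R_ratio \<mu> q \<gamma> has_real_derivative 0) (at x)"
  shows "R_ratio \<mu> q \<gamma> x = stationary_value \<mu> q \<gamma> x"
proof -
  have eq: "R_ratio \<mu> q \<gamma> x * ratio_den_logderiv \<mu> q \<gamma> x = 1 / bessel_r \<mu> x"
    using DERIV_unique[OF R_ratio_deriv[OF assms(1-3)] assms(4)] by simp
  then have "ratio_den_logderiv \<mu> q \<gamma> x \<noteq> 0"
    using bessel_r_pos[OF assms(3,1)] by auto
  then have "R_ratio \<mu> q \<gamma> x = 1 / bessel_r \<mu> x / ratio_den_logderiv \<mu> q \<gamma> x"
    unfolding eq[symmetric] by simp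
  then show ?thesis
    by (simp add: stationary_value_def ratio_den_logderiv_def)
qed

section \<open>Limits of the ratio at both ends\<close>

lemma ratio_den_at_0:
  assumes "\<mu> > -1" "q > -1"
  shows "(ratio_den \<mu> q \<gamma> \<longlongrightarrow> 0) (at_right 0)"
proof -
  let ?h = "\<lambda>x. 2 powr - (\<mu> + 1) * exp (- \<gamma> * x) * bessel_clifford (\<mu> + 1) ((x / 2) ^ 2)"
  have "isCont ?h 0"
    using assms by (intro continuous_intros isCont_o2[OF _ isCont_bessel_clifford]) auto
  then have "(?h \<longlongrightarrow> ?h 0) (at_right 0)"
    by (rule tendsto_within_subset[OF isContD]) simp
  moreover have "((\<lambda>x. x powr (q + 1)) \<longlongrightarrow> 0 powr (q + 1)) (at_right (0::real))"
    using assms(2)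
    by (intro tendsto_powr2 tendsto_const tendsto_ident_at)
       (auto intro: eventually_mono[OF eventually_at_right_less[of 0]])
  ultimately have "((\<lambda>x. ?h x * x powr (q + 1)) \<longlongrightarrow> 0) (at_right 0)"
    using tendsto_mult by fastforce
  moreover have "\<forall>\<^sub>F x in at_right 0. ?h x * x powr (q + 1) = ratio_den \<mu> q \<gamma> x"
    using eventually_at_right_less[of 0]
    by eventually_elim (simp add: ratio_den_eq assms)
  ultimately show ?thesis by (rule Lim_transform_eventually)
qed

text \<open>Here \<open>L\<close> has a pole and \<open>r\<^sub>\<mu>\<close> a zero, both of order one, so the quotient of the derivatives is
  rewritten as \<open>1 / ((r\<^sub>\<mu> / x) (x L))\<close>, in which both factors have finite nonzero limits.\<close>

lemma R_ratio_at_0: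
  assumes "\<mu> > -1" "q > -1"
  shows "(R_ratio \<mu> q \<gamma> \<longlongrightarrow> 2 * (\<mu> + 1) / (q + 1)) (at_right 0)"
proof -
  let ?D = "ratio_den \<mu> q \<gamma>" and ?L = "ratio_den_logderiv \<mu> q \<gamma>"
  have pos: "\<forall>\<^sub>F x in at_right (0::real). x > 0" by (rule eventually_at_right_less)
  have "((\<lambda>x. bessel_r (\<mu> + 1) x / x * x * x + (q + 1) - \<gamma> * x) \<longlongrightarrow>
      1 / (2 * (\<mu> + 1 + 1)) * 0 * 0 + (q + 1) - \<gamma> * 0) (at_right 0)"
    using assms by (intro tendsto_intros bessel_r_over_x_at_0) auto
  moreover have "\<forall>\<^sub>F x in at_right 0. bessel_r (\<mu> + 1) x / x * x * x + (q + 1) - \<gamma> * x = x * ?L x"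
    using pos by eventually_elim (simp add: ratio_den_logderiv_def field_simps)
  ultimately have xL: "((\<lambda>x. x * ?L x) \<longlongrightarrow> q + 1) (at_right 0)"
    by (simp add: tendsto_cong)
  have "((\<lambda>x. 1 / (bessel_r \<mu> x / x * (x * ?L x))) \<longlongrightarrow> 1 / (1 / (2 * (\<mu> + 1)) * (q + 1))) (at_right 0)"
    using assms by (intro tendsto_intros bessel_r_over_x_at_0 xL) auto
  moreover have "\<forall>\<^sub>F x in at_right 0.
      1 / (bessel_r \<mu> x / x * (x * ?L x)) = ?D x / bessel_r \<mu> x / (?D x * ?L x)"
    using pos
  proof eventually_elim
    case (elim x)
    then show ?case using ratio_den_pos[OF assms(1) elim, of q \<gamma>] by simp
  qed
  ultimately have lim: "((\<lambda>x. ?D x / bessel_r \<mu> x / (?D x * ?L x)) \<longlongrightarrow> 2 * (\<mu> + 1) / (q + 1)) (at_right 0)"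
    using assms by (simp add: tendsto_cong)
  have "\<forall>\<^sub>F x in at_right 0. x * ?L x > 0"
    using order_tendstoD(1)[OF xL, of 0] assms by simp
  then have nz: "\<forall>\<^sub>F x in at_right 0. ?D x * ?L x \<noteq> 0"
    using pos
  proof eventually_elim
    case (elim x)
    then show ?case
      using ratio_den_pos[OF assms(1) elim(2), of q \<gamma>] by (simp add: zero_less_mult_iff)
  qed
  show ?thesis
    unfolding R_ratio_eq[abs_def]
  proof (rule lhopital_right_0[OF _ ratio_den_at_0 _ nz _ _ lim])
    show "(ratio_num \<mu> q \<gamma> \<longlongrightarrow> 0) (at_right 0)"
      unfolding ratio_num_eq[OF assms(1), abs_def]
      using assms continuous_ratio_weight by (intro integral_powr_times_continuous_at_0) auto
    show "\<forall>\<^sub>F x in at_right 0. ?D x \<noteq> 0"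
      using pos by eventually_elim (rule ratio_den_pos[OF assms(1), THEN less_imp_neq, THEN not_sym])
    show "\<forall>\<^sub>F x in at_right 0. (ratio_num \<mu> q \<gamma> has_real_derivative ?D x / bessel_r \<mu> x) (at x)"
      using pos by eventually_elim (rule ratio_num_deriv[OF assms])
    show "\<forall>\<^sub>F x in at_right 0. (?D has_real_derivative ?D x * ?L x) (at x)"
      using pos by eventually_elim (rule ratio_den_deriv[OF assms(1)])
  qed (use assms in auto)
qed

lemma ratio_den_logderiv_at_top:
  assumes "\<mu> > -1"
  shows "(ratio_den_logderiv \<mu> q \<gamma> \<longlongrightarrow> 1 - \<gamma>) at_top"
proof -
  have "((\<lambda>x. (q + 1) / x) \<longlongrightarrow> 0) at_top"
    by (rule tendsto_divide_0[OF tendsto_const]) (simp add: filterlim_ident filterlim_at_top_imp_at_infinity)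
  then have "((\<lambda>x. bessel_r (\<mu> + 1) x + (q + 1) / x - \<gamma>) \<longlongrightarrow> 1 + 0 - \<gamma>) at_top"
    using assms by (intro tendsto_intros bessel_r_at_top) auto
  then show ?thesis by (simp add: ratio_den_logderiv_def[abs_def])
qed

text \<open>Under these hypotheses \<open>f x exp (-c x)\<close> is nondecreasing on \<open>{X..}\<close>, so \<open>f\<close> grows at least like
  \<open>exp (c x)\<close>.\<close>

lemma filterlim_at_top_if_logderiv_ge:
  fixes f :: "real \<Rightarrow> real"
  assumes "c > 0" "f X > 0"
    and deriv: "\<And>x. x \<ge> X \<Longrightarrow> (f has_real_derivative f x * l x) (at x)"
    and bound: "\<And>x. x \<ge> X \<Longrightarrow> f x > 0 \<and> l x \<ge> c"
  shows "filterlim f at_top at_top"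
proof (rule filterlim_at_top_mono)
  have lin: "filterlim (\<lambda>x. c * x) at_top at_top"
    using assms(1) by (intro filterlim_tendsto_pos_mult_at_top[OF tendsto_const] filterlim_ident) auto
  show "filterlim (\<lambda>x. f X * exp (- c * X) * exp (c * x)) at_top at_top"
    using assms(2)
    by (intro filterlim_tendsto_pos_mult_at_top[OF tendsto_const _ filterlim_compose[OF exp_at_top lin]]) simp
  show "\<forall>\<^sub>F x in at_top. f X * exp (- c * X) * exp (c * x) \<le> f x"
    using eventually_ge_at_top[of X]
  proof eventually_elim
    case (elim x)
    have "f X * exp (- c * X) \<le> f x * exp (- c * x)"
    proof (rule DERIV_nonneg_imp_nondecreasing[OF elim])
      fix y assume "X \<le> y"
      have "((\<lambda>x. f x * exp (- c * x)) has_real_derivative f y * exp (- c * y) * (l y - c)) (at y)"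
        using deriv[OF \<open>X \<le> y\<close>] by (auto intro!: derivative_eq_intros simp: algebra_simps)
      then show "\<exists>d. ((\<lambda>x. f x * exp (- c * x)) has_real_derivative d) (at y) \<and> d \<ge> 0"
        using bound[OF \<open>X \<le> y\<close>] by (intro exI conjI) auto
    qed
    then have "f X * exp (- c * X) * exp (c * x) \<le> f x * exp (- c * x) * exp (c * x)"
      by (rule mult_right_mono) simp
    then show ?case by (simp add: mult.assoc flip: exp_add)
  qed
qed

lemma ratio_den_at_top:
  assumes "\<mu> > -1" "\<gamma> < 1"
  shows "filterlim (ratio_den \<mu> q \<gamma>) at_top at_top"
proof -
  \<comment> \<open>Any positive bound below the limit \<open>1 - \<gamma>\<close> of the logarithmic derivative would do.\<close>
  have "\<forall>\<^sub>F x in at_top. ratio_den_logderiv \<mu> q \<gamma> x > (1 - \<gamma>) / 2"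
    by (intro order_tendstoD(1)[OF ratio_den_logderiv_at_top]) (use assms in auto)
  then obtain X0 where X0: "\<And>x. x \<ge> X0 \<Longrightarrow> ratio_den_logderiv \<mu> q \<gamma> x > (1 - \<gamma>) / 2"
    by (auto simp: eventually_at_top_linorder)
  show ?thesis
  proof (rule filterlim_at_top_if_logderiv_ge[where X = "max X0 1" and c = "(1 - \<gamma>) / 2"])
    fix x assume "x \<ge> max X0 1"
    then have x: "x \<ge> X0" "x > 0" by auto
    then show "(ratio_den \<mu> q \<gamma> has_real_derivative
        ratio_den \<mu> q \<gamma> x * ratio_den_logderiv \<mu> q \<gamma> x) (at x)"
      by (intro ratio_den_deriv assms)
    show "ratio_den \<mu> q \<gamma> x > 0 \<and> ratio_den_logderiv \<mu> q \<gamma> x \<ge> (1 - \<gamma>) / 2"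
      using ratio_den_pos[OF assms(1) x(2)] X0[OF x(1)] by (simp add: less_imp_le)
  qed (use assms ratio_den_pos in auto)
qed

text \<open>The denominator diverges, so l'Hospital's rule reduces the claim to \<open>1 / (r\<^sub>\<mu> L) \<rightarrow> 1 / (1 - \<gamma>)\<close>.\<close>

lemma R_ratio_at_top:
  assumes "\<mu> > -1" "q > -1" "\<gamma> < 1"
  shows "(R_ratio \<mu> q \<gamma> \<longlongrightarrow> 1 / (1 - \<gamma>)) at_top"
proof -
  let ?D = "ratio_den \<mu> q \<gamma>" and ?L = "ratio_den_logderiv \<mu> q \<gamma>"
  have pos: "\<forall>\<^sub>F x in at_top. x > (0::real)" by (rule eventually_gt_at_top)
  have "((\<lambda>x. 1 / (bessel_r \<mu> x * ?L x)) \<longlongrightarrow> 1 / (1 * (1 - \<gamma>))) at_top"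
    using assms by (intro tendsto_intros bessel_r_at_top ratio_den_logderiv_at_top) auto
  moreover have "\<forall>\<^sub>F x in at_top. 1 / (bessel_r \<mu> x * ?L x) = ?D x / bessel_r \<mu> x / (?D x * ?L x)"
    using pos
  proof eventually_elim
    case (elim x)
    then show ?case using ratio_den_pos[OF assms(1) elim, of q \<gamma>] by simp
  qed
  ultimately have lim: "((\<lambda>x. ?D x / bessel_r \<mu> x / (?D x * ?L x)) \<longlongrightarrow> 1 / (1 - \<gamma>)) at_top"
    by (simp add: tendsto_cong)
  have "\<forall>\<^sub>F x in at_top. ?L x > 0"
    by (intro order_tendstoD(1)[OF ratio_den_logderiv_at_top]) (use assms in auto)
  then have nz: "\<forall>\<^sub>F x in at_top. ?D x * ?L x \<noteq> 0"
    using pos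
  proof eventually_elim
    case (elim x)
    then show ?case using ratio_den_pos[OF assms(1) elim(2), of q \<gamma>] by simp
  qed
  show ?thesis
    unfolding R_ratio_eq[abs_def]
  proof (rule lhospital_at_top_at_top[OF ratio_den_at_top nz _ _ lim])
    show "\<forall>\<^sub>F x in at_top. (ratio_num \<mu> q \<gamma> has_real_derivative ?D x / bessel_r \<mu> x) (at x)"
      using pos by eventually_elim (rule ratio_num_deriv[OF assms(1,2)])
    show "\<forall>\<^sub>F x in at_top. (?D has_real_derivative ?D x * ?L x) (at x)"
      using pos by eventually_elim (rule ratio_den_deriv[OF assms(1)])
  qed (use assms in auto)
qed

section \<open>Suprema over the half-line\<close>

text \<open>A value above both end limits exceeds all values outside some compact interval, so the maximum
  over that interval is a global one, and it is attained at a stationary point.\<close>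

lemma stationary_point_above_end_limits:
  fixes f :: "real \<Rightarrow> real"
  assumes deriv: "\<And>x. x > 0 \<Longrightarrow> (f has_real_derivative f' x) (at x)"
    and lim0: "(f \<longlongrightarrow> a) (at_right 0)" and lim_top: "(f \<longlongrightarrow> b) at_top"
    and x: "x > 0" "f x > a" "f x > b"
  obtains z where "z > 0" "f z \<ge> f x" "(f has_real_derivative 0) (at z)"
proof -
  obtain d where d: "d > 0" "\<And>y. 0 < y \<Longrightarrow> y < d \<Longrightarrow> f y < f x"
    using order_tendstoD(2)[OF lim0 x(2)] by (auto simp: eventually_at_right_field)
  obtain K where K: "\<And>y. y \<ge> K \<Longrightarrow> f y < f x"
    using order_tendstoD(2)[OF lim_top x(3)] by (auto simp: eventually_at_top_linorder)
  have "continuous_on {d..K} f"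
    using deriv d(1) by (intro continuous_at_imp_continuous_on ballI DERIV_isCont[OF deriv]) auto
  moreover have x_in: "x \<in> {d..K}"
    using d(2)[of x] K[of x] x(1) by force
  ultimately obtain z where z: "z \<in> {d..K}" "\<And>y. y \<in> {d..K} \<Longrightarrow> f y \<le> f z"
    using continuous_attains_sup[of "{d..K}" f] by auto
  have max: "f y \<le> f z" if "y > 0" for y
    using z(2)[of y] z(2)[OF x_in] d(2)[of y] K[of y] that by force
  have "z > 0" using z(1) d(1) by auto
  moreover from this have "f' z = 0"
    using max by (intro DERIV_local_max[OF deriv, of z z]) auto
  ultimately show thesis
    using that[of z] deriv[of z] max[OF x(1)] by simp
qed

theorem proposition6p4:
  fixes \<mu> q \<gamma> :: real
  assumes "\<mu> > -1" and "q > -1" and "0 < \<gamma>" and "\<gamma> < 1"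
  shows "(\<forall>x0>0. (R_ratio \<mu> q \<gamma> has_real_derivative 0) (at x0) \<longrightarrow>
            R_ratio \<mu> q \<gamma> x0 = stationary_value \<mu> q \<gamma> x0) \<and>
         M_star \<mu> q \<gamma> =
           Max ({ereal (2 * (\<mu> + 1) / (q + 1)), ereal (1 / (1 - \<gamma>))} \<union>
                (if R_stationary \<mu> q \<gamma> = {} then {}
                 else {SUP x\<in>R_stationary \<mu> q \<gamma>. ereal (stationary_value \<mu> q \<gamma> x)}))"
    (is "?stat \<and> M_star \<mu> q \<gamma> = Max ?S")
proof
  let ?R = "R_ratio \<mu> q \<gamma>" and ?V = "stationary_value \<mu> q \<gamma>"
  let ?a = "2 * (\<mu> + 1) / (q + 1)" and ?b = "1 / (1 - \<gamma>)"
  show ?stat using R_ratio_at_stationary[OF assms(1,2)] by blast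
  have R_stat: "ereal (?V x) = ereal (?R x)" if "x \<in> R_stationary \<mu> q \<gamma>" for x
    using that R_ratio_at_stationary[OF assms(1,2)] by (auto simp: R_stationary_def)
  have upper: "ereal (?R x) \<le> M_star \<mu> q \<gamma>" if "x > 0" for x
    unfolding M_star_def using that by (intro SUP_upper) simp
  note lim0 = R_ratio_at_0[OF assms(1,2), of \<gamma>] and lim_top = R_ratio_at_top[OF assms(1,2,4)]
  show "M_star \<mu> q \<gamma> = Max ?S"
  proof (rule antisym)
    show "M_star \<mu> q \<gamma> \<le> Max ?S"
      unfolding M_star_def
    proof (rule SUP_least)
      fix x :: real assume "x \<in> {0<..}"
      then have x: "x > 0" by simp
      have "\<exists>s\<in>?S. ereal (?R x) \<le> s"
      proof (cases "?R x \<le> ?a \<or> ?R x \<le> ?b")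
        case False
        then have gt: "?R x > ?a" "?R x > ?b" by auto
        obtain z where z: "z > 0" "?R z \<ge> ?R x" "(?R has_real_derivative 0) (at z)"
          using stationary_point_above_end_limits[OF R_ratio_deriv[OF assms(1,2)] lim0 lim_top x gt]
          by blast
        then have mem: "z \<in> R_stationary \<mu> q \<gamma>" by (simp add: R_stationary_def)
        have "ereal (?R x) \<le> ereal (?V z)" using z(2) R_stat[OF mem] by simp
        also have "\<dots> \<le> (SUP x\<in>R_stationary \<mu> q \<gamma>. ereal (?V x))" using mem by (rule SUP_upper)
        finally show ?thesis using mem by auto
      qed auto
      then obtain s where "s \<in> ?S" "ereal (?R x) \<le> s" ..
      moreover have "finite ?S" by simp
      ultimately show "ereal (?R x) \<le> Max ?S" using Max_ge order_trans by blast
    qed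
  next
    have "ereal ?a \<le> M_star \<mu> q \<gamma>"
    proof (rule tendsto_upperbound)
      show "((\<lambda>x. ereal (?R x)) \<longlongrightarrow> ereal ?a) (at_right 0)" using lim0 by simp
      show "\<forall>\<^sub>F x in at_right 0. ereal (?R x) \<le> M_star \<mu> q \<gamma>"
        using eventually_at_right_less[of 0] by eventually_elim (rule upper)
    qed simp
    moreover have "ereal ?b \<le> M_star \<mu> q \<gamma>"
    proof (rule tendsto_upperbound)
      show "((\<lambda>x. ereal (?R x)) \<longlongrightarrow> ereal ?b) at_top" using lim_top by simp
      show "\<forall>\<^sub>F x in at_top. ereal (?R x) \<le> M_star \<mu> q \<gamma>"
        using eventually_gt_at_top[of 0] by eventually_elim (rule upper)
    qed simp
    moreover have "(SUP x\<in>R_stationary \<mu> q \<gamma>. ereal (?V x)) \<le> M_star \<mu> q \<gamma>"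
      using R_stat upper by (intro SUP_least) (simp add: R_stationary_def)
    ultimately show "Max ?S \<le> M_star \<mu> q \<gamma>"
      by (intro Max.boundedI) (auto split: if_splits)
  qed
qed

end
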